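(* Let $A$ be a linear order such that $A^{\omega}$ does not have a parity-reversing automorphism. Then there exists a linear order $X$ such that $A^2X\cong X$ but $AX\not\cong X$.
   Context: Products are lexicographic. $A^\omega$: infinite sequences of elements of $A$ ordered lexicographically; $au$ prepends $a$ to $u$. $u\sim_2 v$ iff there exist finite sequences $r,s$ with $|r|\equiv|s|\pmod 2$ and $u'\in A^\omega$ with $u=ru'$, $v=su'$. A parity-reversing automorphism of $A^\omega$ is an order automorphism $f$ with $f(u)\sim_2 au$ for all $u\in A^\omega$, $a\in A$. *)

theory Defs
  imports Main "HOL-Library.Stream"
begin

text \<open>
  A linear order is a reflexive relation \<open>r\<close> with \<^term>\<open>Linear_order r\<close>; its set of points
  is \<^term>\<open>Field r\<close>, which may be empty.  The library predicate \<^const>\<open>iso\<close> is stated via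
  initial segments; for arbitrary relations it amounts to a bijection of the fields that
  preserves and reflects the relation (see \<open>iso_iff2\<close>).

  Existence of a linear order is stated on a fixed carrier type, since HOL has no quantifier
  over types: for orders obtained from \<open>r :: 'a rel\<close> the type \<open>'a stream \<times> 'a stream set\<close> has room
  for one copy of the successor cardinal of the type of sequences in place of each sequence.
\<close>

definition order_isomorphic :: "'a rel \<Rightarrow> 'b rel \<Rightarrow> bool" (infix "\<cong>\<^sub>o" 50) where
  "r \<cong>\<^sub>o s \<longleftrightarrow> (\<exists>f. iso r s f)"

text \<open>The first coordinate dominates: every point of \<open>r\<close> is replaced by a copy of \<open>s\<close>.\<close>

definition lex_product :: "'a rel \<Rightarrow> 'b rel \<Rightarrow> ('a \<times> 'b) rel" (infixr "\<otimes>\<^sub>l" 70) where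
  "r \<otimes>\<^sub>l s = {((a, x), (b, y)).
     a \<in> Field r \<and> b \<in> Field r \<and> x \<in> Field s \<and> y \<in> Field s \<and>
     ((a, b) \<in> r \<and> a \<noteq> b \<or> a = b \<and> (x, y) \<in> s)}"

definition omega_power :: "'a rel \<Rightarrow> 'a stream rel" where
  "omega_power r = {(u, v).
     u \<in> streams (Field r) \<and> v \<in> streams (Field r) \<and>
     (u = v \<or> (\<exists>n. (\<forall>m<n. u !! m = v !! m) \<and> u !! n \<noteq> v !! n \<and> (u !! n, v !! n) \<in> r))}"

definition sim2 :: "'a set \<Rightarrow> 'a stream \<Rightarrow> 'a stream \<Rightarrow> bool" where
  "sim2 S u v \<longleftrightarrow>
     (\<exists>p\<in>lists S. \<exists>q\<in>lists S. \<exists>w\<in>streams S.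
        length p mod 2 = length q mod 2 \<and> u = p @- w \<and> v = q @- w)"

definition parity_reversing_automorphism :: "'a rel \<Rightarrow> ('a stream \<Rightarrow> 'a stream) \<Rightarrow> bool" where
  "parity_reversing_automorphism r f \<longleftrightarrow>
     iso (omega_power r) (omega_power r) f \<and>
     (\<forall>u\<in>streams (Field r). \<forall>a\<in>Field r. sim2 (Field r) (f u) (a ## u))"

lemma Field_lex_product:
  assumes "Linear_order r" "Linear_order s"
  shows "Field (r \<otimes>\<^sub>l s) = Field r \<times> Field s"
  using assms
  by (fastforce simp: lex_product_def Field_def order_on_defs refl_on_def)

lemma Linear_order_lex_product:
  assumes r: "Linear_order r" and s: "Linear_order s"
  shows "Linear_order (r \<otimes>\<^sub>l s)"
proof -
  have "refl_on (Field r \<times> Field s) (r \<otimes>\<^sub>l s)" "r \<otimes>\<^sub>l s \<subseteq> (Field r \<times> Field s) \<times> (Field r \<times> Field s)"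
    using s by (auto simp: lex_product_def order_on_defs refl_on_def)
  moreover have "antisym (r \<otimes>\<^sub>l s)"
    using r s unfolding lex_product_def order_on_defs antisym_def by auto
  moreover have "trans (r \<otimes>\<^sub>l s)"
  proof -
    have tr: "\<And>x y z. (x, y) \<in> r \<Longrightarrow> (y, z) \<in> r \<Longrightarrow> (x, z) \<in> r"
      and ts: "\<And>x y z. (x, y) \<in> s \<Longrightarrow> (y, z) \<in> s \<Longrightarrow> (x, z) \<in> s"
      and ar: "\<And>x y. (x, y) \<in> r \<Longrightarrow> (y, x) \<in> r \<Longrightarrow> x = y"
      using r s unfolding order_on_defs trans_def antisym_def by blast+
    show ?thesis
    proof (rule transI)
      fix p q t assume "(p, q) \<in> r \<otimes>\<^sub>l s" "(q, t) \<in> r \<otimes>\<^sub>l s"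
      then show "(p, t) \<in> r \<otimes>\<^sub>l s"
        unfolding lex_product_def
        by (cases p; cases q; cases t; simp) (metis tr ts ar)
    qed
  qed
  moreover have "total_on (Field r \<times> Field s) (r \<otimes>\<^sub>l s)"
    using r s unfolding lex_product_def order_on_defs total_on_def by auto
  ultimately show ?thesis
    unfolding Field_lex_product[OF r s] order_on_defs by auto
qed

lemma Field_omega_power: "Field (omega_power r) = streams (Field r)"
  by (auto simp: omega_power_def Field_def)

lemma Linear_order_omega_power:
  assumes r: "Linear_order r"
  shows "Linear_order (omega_power r)"
proof -
  have tr: "trans r" and an: "antisym r" and tot: "total_on (Field r) r"
    using r by (auto simp: order_on_defs)
  have "refl_on (streams (Field r)) (omega_power r)"
    "omega_power r \<subseteq> streams (Field r) \<times> streams (Field r)"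
    by (auto simp: omega_power_def refl_on_def)
  moreover have "antisym (omega_power r)"
  proof (rule antisymI, rule ccontr)
    fix u v assume uv: "(u, v) \<in> omega_power r" "(v, u) \<in> omega_power r" "u \<noteq> v"
    then obtain m n where
      m: "\<forall>i<m. u !! i = v !! i" "u !! m \<noteq> v !! m" "(u !! m, v !! m) \<in> r" and
      n: "\<forall>i<n. v !! i = u !! i" "v !! n \<noteq> u !! n" "(v !! n, u !! n) \<in> r"
      by (auto simp: omega_power_def)
    have "m = n" using m n by (metis linorder_neqE_nat)
    then show False using m n antisymD[OF an] by blast
  qed
  moreover have "trans (omega_power r)"
  proof (rule transI)
    fix u v w assume uv: "(u, v) \<in> omega_power r" and vw: "(v, w) \<in> omega_power r"
    show "(u, w) \<in> omega_power r"
    proof (cases "u = v \<or> v = w")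
      case True then show ?thesis using uv vw by auto
    next
      case False
      then obtain m n where
        m: "\<forall>i<m. u !! i = v !! i" "u !! m \<noteq> v !! m" "(u !! m, v !! m) \<in> r" and
        n: "\<forall>i<n. v !! i = w !! i" "v !! n \<noteq> w !! n" "(v !! n, w !! n) \<in> r"
        using uv vw by (auto simp: omega_power_def)
      define k where "k = min m n"
      have "\<forall>i<k. u !! i = w !! i" using m n by (auto simp: k_def)
      moreover have "u !! k \<noteq> w !! k \<and> (u !! k, w !! k) \<in> r"
      proof (cases m n rule: linorder_cases)
        case less then show ?thesis using m n by (auto simp: k_def min_def)
      next
        case equal then show ?thesis using m n transD[OF tr, of "u !! m" "v !! m" "w !! m"] antisymD[OF an, of "u !! m" "v !! m"]
          by (auto simp: k_def)
      next
        case greater then show ?thesis using m n by (auto simp: k_def min_def)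
      qed
      ultimately show ?thesis using uv vw by (auto simp: omega_power_def)
    qed
  qed
  moreover have "total_on (streams (Field r)) (omega_power r)"
  proof (rule total_onI)
    fix u v assume S: "u \<in> streams (Field r)" "v \<in> streams (Field r)" and "u \<noteq> v"
    then have ex: "\<exists>n. u !! n \<noteq> v !! n"
      by (metis ext smap_alt stream.map_id0 id_apply)
    define n where "n = (LEAST n. u !! n \<noteq> v !! n)"
    have n: "u !! n \<noteq> v !! n" "\<forall>m<n. u !! m = v !! m"
      using LeastI_ex[OF ex] not_less_Least[of _ "\<lambda>n. u !! n \<noteq> v !! n"] unfolding n_def by blast+
    have "u !! n \<in> Field r" "v !! n \<in> Field r"
      using S by (auto simp: streams_iff_snth)
    then have "(u !! n, v !! n) \<in> r \<or> (v !! n, u !! n) \<in> r"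
      using tot n by (auto simp: total_on_def)
    then show "(u, v) \<in> omega_power r \<or> (v, u) \<in> omega_power r"
    proof
      assume "(u !! n, v !! n) \<in> r"
      then have "(u, v) \<in> omega_power r" using S n unfolding omega_power_def by blast
      then show ?thesis ..
    next
      assume "(v !! n, u !! n) \<in> r"
      then have "(v, u) \<in> omega_power r"
        using S n(1)[symmetric] n(2)[THEN spec, THEN mp, THEN sym] unfolding omega_power_def by blast
      then show ?thesis ..
    qed
  qed
  ultimately show ?thesis
    unfolding Field_omega_power order_on_defs by auto
qed

end

theory Submission
  imports Defs "HOL-Library.FuncSet"
begin

text \<open>
  Let \<open>X\<close> be \<open>A\<^sup>\<omega>\<close> with each sequence \<open>u\<close> replaced by a copy of \<open>I\<^sub>C = \<int> + \<alpha>\<^sub>C\<close>, where \<open>C\<close> is the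
  \<open>\<sim>\<^sub>2\<close>-class of \<open>u\<close> and the ordinals \<open>\<alpha>\<^sub>C\<close> are distinct for distinct classes.
  Prepending two letters does not change the class, so \<open>A\<^sup>2X \<cong> X\<close>, whereas \<open>AX\<close> is
  \<open>A\<^sup>\<omega>\<close> with each \<open>au\<close> replaced by the order belonging to \<open>u\<close>.  In \<open>I\<^sub>C\<close> there is no least element, but
  every nonempty subset that is bounded below has one; hence an isomorphic image of \<open>I\<^sub>C\<close> cannot be
  spread over several copies, and an isomorphism \<open>AX \<cong> X\<close> permutes the copies.  It thus induces an
  automorphism \<open>f\<close> of \<open>A\<^sup>\<omega>\<close> such that \<open>f(au)\<close> and \<open>u\<close> are replaced by isomorphic orders, that is,
  \<open>f(au) \<sim>\<^sub>2 u \<sim>\<^sub>2 bau\<close>: it is parity-reversing.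
\<close>

section \<open>Linear orders and isomorphisms\<close>

lemma Linear_order_refl: "Linear_order r \<Longrightarrow> x \<in> Field r \<Longrightarrow> (x, x) \<in> r"
  by (simp add: order_on_defs refl_on_def)

lemma Linear_order_trans: "Linear_order r \<Longrightarrow> (x, y) \<in> r \<Longrightarrow> (y, z) \<in> r \<Longrightarrow> (x, z) \<in> r"
  by (auto simp: order_on_defs dest: transD)

lemma Linear_order_antisym: "Linear_order r \<Longrightarrow> antisym r"
  by (simp add: order_on_defs)

lemma Linear_order_linear:
  "Linear_order r \<Longrightarrow> x \<in> Field r \<Longrightarrow> y \<in> Field r \<Longrightarrow> (x, y) \<in> r \<or> (y, x) \<in> r"
  by (metis Linear_order_refl linear_order_on_def total_on_def)

lemma iso_inv_into:
  assumes "iso r s f"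
  shows "iso s r (inv_into (Field r) f)"
proof -
  have bij: "bij_betw f (Field r) (Field s)"
    and iff: "\<And>a b. a \<in> Field r \<Longrightarrow> b \<in> Field r \<Longrightarrow> (a, b) \<in> r \<longleftrightarrow> (f a, f b) \<in> s"
    using assms by (auto simp: iso_iff2)
  have "inv_into (Field r) f y \<in> Field r" "f (inv_into (Field r) f y) = y" if "y \<in> Field s" for y
    using that bij by (auto simp: bij_betw_def inv_into_into f_inv_into_f)
  with iff bij_betw_inv_into[OF bij] show ?thesis
    by (simp add: iso_iff2)
qed

lemma iso_if_strict_mono_surj:
  assumes r: "Linear_order r" and s: "Linear_order s"
    and surj: "f ` Field r = Field s"
    and mono: "\<And>a b. (a, b) \<in> r \<Longrightarrow> a \<noteq> b \<Longrightarrow> (f a, f b) \<in> s \<and> f a \<noteq> f b"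
  shows "iso r s f"
  unfolding iso_iff2
proof (intro conjI ballI)
  have inj: "inj_on f (Field r)"
    using mono Linear_order_linear[OF r] by (metis inj_onI)
  then show "bij_betw f (Field r) (Field s)"
    using surj by (simp add: bij_betw_def)
  fix a b assume ab: "a \<in> Field r" "b \<in> Field r"
  show "(a, b) \<in> r \<longleftrightarrow> (f a, f b) \<in> s"
  proof (cases "a = b")
    case True
    then show ?thesis
      using ab surj Linear_order_refl[OF r] Linear_order_refl[OF s] by blast
  next
    case False
    then show ?thesis
      using ab mono Linear_order_linear[OF r] antisymD[OF Linear_order_antisym[OF s]] by metis
  qed
qed

lemma order_isomorphic_refl: "r \<cong>\<^sub>o r"
  by (auto simp: order_isomorphic_def intro: id_iso)

lemma order_isomorphic_sym: "r \<cong>\<^sub>o s \<Longrightarrow> s \<cong>\<^sub>o r"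
  by (auto simp: order_isomorphic_def dest: iso_inv_into)

lemma order_isomorphic_trans [trans]: "r \<cong>\<^sub>o s \<Longrightarrow> s \<cong>\<^sub>o t \<Longrightarrow> r \<cong>\<^sub>o t"
  by (auto simp: order_isomorphic_def dest: comp_iso)

lemma order_isomorphic_dir_image:
  assumes "inj_on f (Field r)"
  shows "r \<cong>\<^sub>o dir_image r f"
proof -
  have "(a, b) \<in> r \<longleftrightarrow> (f a, f b) \<in> dir_image r f" if "a \<in> Field r" "b \<in> Field r" for a b
    using that assms unfolding dir_image_def
    by (auto simp: inj_on_eq_iff FieldI1 FieldI2)
  then have "iso r (dir_image r f) f"
    using assms by (simp add: iso_iff2 dir_image_Field bij_betw_def)
  then show ?thesis
    by (auto simp: order_isomorphic_def)
qed

definition interval :: "'a rel \<Rightarrow> 'a \<Rightarrow> 'a \<Rightarrow> 'a set" where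
  "interval r x y = {z. (x, z) \<in> r \<and> (z, y) \<in> r}"

lemma interval_subset_Field: "interval r x y \<subseteq> Field r"
  by (auto simp: interval_def intro: FieldI1)

lemma iso_image_interval:
  assumes f: "iso r s f" and xy: "x \<in> Field r" "y \<in> Field r"
  shows "f ` interval r x y = interval s (f x) (f y)"
proof
  show "f ` interval r x y \<subseteq> interval s (f x) (f y)"
    by (auto simp: interval_def intro: iso_forward[OF _ f])
  show "interval s (f x) (f y) \<subseteq> f ` interval r x y"
  proof
    fix z assume z: "z \<in> interval s (f x) (f y)"
    then have "z \<in> f ` Field r"
      using interval_subset_Field[of s] iso_Field[OF f] by auto
    then obtain c where "c \<in> Field r" "z = f c"
      by blast
    then show "z \<in> f ` interval r x y"
      using f xy z by (auto simp: interval_def iso_iff2)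
  qed
qed

section \<open>Sums over a linear order\<close>

definition lex_sum :: "'a rel \<Rightarrow> ('a \<Rightarrow> 'b rel) \<Rightarrow> ('a \<times> 'b) rel" where
  "lex_sum r I = {((a, x), (b, y)).
     a \<in> Field r \<and> b \<in> Field r \<and> x \<in> Field (I a) \<and> y \<in> Field (I b) \<and>
     ((a, b) \<in> r \<and> a \<noteq> b \<or> a = b \<and> (x, y) \<in> I a)}"

lemma lex_product_eq_lex_sum: "r \<otimes>\<^sub>l s = lex_sum r (\<lambda>_. s)"
  by (simp add: lex_product_def lex_sum_def)

lemma lex_sum_iff:
  "((a, x), (b, y)) \<in> lex_sum r I \<longleftrightarrow>
     a \<in> Field r \<and> b \<in> Field r \<and> x \<in> Field (I a) \<and> y \<in> Field (I b) \<and>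
     ((a, b) \<in> r \<and> a \<noteq> b \<or> a = b \<and> (x, y) \<in> I a)"
  by (simp add: lex_sum_def)

lemma Field_lex_sum: "Field (lex_sum r I) = (SIGMA a:Field r. Field (I a))"
proof
  show "Field (lex_sum r I) \<subseteq> (SIGMA a:Field r. Field (I a))"
    by (auto simp: Field_def[of "lex_sum r I"] lex_sum_iff)
  show "(SIGMA a:Field r. Field (I a)) \<subseteq> Field (lex_sum r I)"
  proof clarify
    fix a x assume a: "a \<in> Field r" and x: "x \<in> Field (I a)"
    then obtain y where "(x, y) \<in> I a \<or> (y, x) \<in> I a"
      by (auto simp: Field_def)
    then have "((a, x), (a, y)) \<in> lex_sum r I \<or> ((a, y), (a, x)) \<in> lex_sum r I"
      using a x by (auto simp: lex_sum_iff intro: FieldI1 FieldI2)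
    then show "(a, x) \<in> Field (lex_sum r I)"
      by (auto intro: FieldI1 FieldI2)
  qed
qed

lemma Linear_order_lex_sum:
  assumes r: "Linear_order r" and I: "\<And>a. a \<in> Field r \<Longrightarrow> Linear_order (I a)"
  shows "Linear_order (lex_sum r I)"
proof -
  note antisym_r = antisymD[OF Linear_order_antisym[OF r]]
  note antisym_I = antisymD[OF Linear_order_antisym[OF I]]
  have "Refl (lex_sum r I)"
    unfolding refl_on_def Field_lex_sum
    using Linear_order_refl[OF I] by (auto simp: lex_sum_iff)
  moreover have "lex_sum r I \<subseteq> Field (lex_sum r I) \<times> Field (lex_sum r I)"
    by (auto intro: FieldI1 FieldI2)
  moreover have "antisym (lex_sum r I)"
  proof (rule antisymI)
    fix p q assume "(p, q) \<in> lex_sum r I" "(q, p) \<in> lex_sum r I"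
    then show "p = q"
      by (cases p; cases q; simp add: lex_sum_iff) (metis antisym_r antisym_I)
  qed
  moreover have "trans (lex_sum r I)"
  proof (rule transI)
    fix p q t assume "(p, q) \<in> lex_sum r I" "(q, t) \<in> lex_sum r I"
    then show "(p, t) \<in> lex_sum r I"
      by (cases p; cases q; cases t; simp add: lex_sum_iff)
        (metis antisym_r Linear_order_trans[OF r] Linear_order_trans[OF I])
  qed
  moreover have "Total (lex_sum r I)"
    unfolding total_on_def Field_lex_sum
    using Linear_order_linear[OF r] Linear_order_linear[OF I] by (fastforce simp: lex_sum_iff)
  ultimately show ?thesis
    by (simp add: order_on_defs)
qed

lemma bij_betw_Sigma:
  assumes g: "bij_betw g A B" and k: "\<And>a. a \<in> A \<Longrightarrow> bij_betw (k a) (X a) (Y (g a))"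
  shows "bij_betw (\<lambda>(a, x). (g a, k a x)) (Sigma A X) (Sigma B Y)"
proof (intro bij_betwI')
  have g_eq_iff: "g a = g b \<longleftrightarrow> a = b" if "a \<in> A" "b \<in> A" for a b
    using g that by (auto simp: bij_betw_def inj_on_eq_iff)
  have k_eq_iff: "k a x = k a y \<longleftrightarrow> x = y" if "a \<in> A" "x \<in> X a" "y \<in> X a" for a x y
    using k[OF that(1)] that by (auto simp: bij_betw_def inj_on_eq_iff)
  show "(\<lambda>(a, x). (g a, k a x)) p = (\<lambda>(a, x). (g a, k a x)) p' \<longleftrightarrow> p = p'"
    if "p \<in> Sigma A X" "p' \<in> Sigma A X" for p p'
    using that g_eq_iff k_eq_iff by auto
  show "(\<lambda>(a, x). (g a, k a x)) p \<in> Sigma B Y" if "p \<in> Sigma A X" for p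
    using that bij_betwE[OF g] bij_betwE[OF k] by auto
next
  fix p assume "p \<in> Sigma B Y"
  then obtain b y where p: "p = (b, y)" "b \<in> B" "y \<in> Y b"
    by auto
  then obtain a where a: "a \<in> A" "g a = b"
    using bij_betw_imp_surj_on[OF g] by (metis imageE)
  then obtain x where "x \<in> X a" "k a x = y"
    using bij_betw_imp_surj_on[OF k[OF a(1)]] p(3) by (metis imageE)
  then show "\<exists>p'\<in>Sigma A X. p = (\<lambda>(a, x). (g a, k a x)) p'"
    using p(1) a by (intro bexI[of _ "(a, x)"]) auto
qed

lemma order_isomorphic_lex_sum_cong:
  assumes g: "iso r q g" and IJ: "\<And>a. a \<in> Field r \<Longrightarrow> I a \<cong>\<^sub>o J (g a)"
  shows "lex_sum r I \<cong>\<^sub>o lex_sum q J"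
proof -
  obtain k where k: "\<And>a. a \<in> Field r \<Longrightarrow> iso (I a) (J (g a)) (k a)"
    using IJ unfolding order_isomorphic_def by metis
  have g_in: "g a \<in> Field q" if "a \<in> Field r" for a
    using iso_Field[OF g] that by blast
  have k_in: "k a x \<in> Field (J (g a))" if "a \<in> Field r" "x \<in> Field (I a)" for a x
    using iso_Field[OF k[OF that(1)]] that(2) by blast
  have g_eq_iff: "g a = g b \<longleftrightarrow> a = b" if "a \<in> Field r" "b \<in> Field r" for a b
    using iso_imp_inj_on[OF g] that by (simp add: inj_on_eq_iff)
  have g_iff: "(g a, g b) \<in> q \<longleftrightarrow> (a, b) \<in> r" if "a \<in> Field r" "b \<in> Field r" for a b
    using g that by (simp add: iso_iff2)
  have k_iff: "(k a x, k a y) \<in> J (g a) \<longleftrightarrow> (x, y) \<in> I a"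
    if "a \<in> Field r" "x \<in> Field (I a)" "y \<in> Field (I a)" for a x y
    using k[OF that(1)] that by (simp add: iso_iff2)
  have "iso (lex_sum r I) (lex_sum q J) (\<lambda>(a, x). (g a, k a x))"
    unfolding iso_iff2 Field_lex_sum
  proof (intro conjI ballI)
    show "bij_betw (\<lambda>(a, x). (g a, k a x))
        (SIGMA a:Field r. Field (I a)) (SIGMA b:Field q. Field (J b))"
      using g k by (intro bij_betw_Sigma) (simp_all add: iso_iff2)
    show "(p, p') \<in> lex_sum r I \<longleftrightarrow>
        ((\<lambda>(a, x). (g a, k a x)) p, (\<lambda>(a, x). (g a, k a x)) p') \<in> lex_sum q J"
      if "p \<in> (SIGMA a:Field r. Field (I a))" "p' \<in> (SIGMA a:Field r. Field (I a))" for p p'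
      using that by (auto simp: lex_sum_iff g_in k_in g_eq_iff g_iff k_iff)
  qed
  then show ?thesis
    by (auto simp: order_isomorphic_def)
qed

lemma order_isomorphic_lex_sum_assoc:
  "lex_sum (lex_sum r I) K \<cong>\<^sub>o lex_sum r (\<lambda>a. lex_sum (I a) (\<lambda>x. K (a, x)))"
proof -
  have "iso (lex_sum (lex_sum r I) K) (lex_sum r (\<lambda>a. lex_sum (I a) (\<lambda>x. K (a, x))))
      (\<lambda>((a, x), z). (a, x, z))"
    unfolding iso_iff2
  proof (intro conjI ballI)
    show "bij_betw (\<lambda>((a, x), z). (a, x, z)) (Field (lex_sum (lex_sum r I) K))
        (Field (lex_sum r (\<lambda>a. lex_sum (I a) (\<lambda>x. K (a, x)))))"
      unfolding Field_lex_sum by (rule bij_betwI[where g = "\<lambda>(a, x, z). ((a, x), z)"]) auto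
  qed (auto simp: lex_sum_iff Field_lex_sum)
  then show ?thesis
    by (auto simp: order_isomorphic_def)
qed

lemma order_isomorphic_lex_product_right: "s \<cong>\<^sub>o t \<Longrightarrow> r \<otimes>\<^sub>l s \<cong>\<^sub>o r \<otimes>\<^sub>l t"
  unfolding lex_product_eq_lex_sum by (rule order_isomorphic_lex_sum_cong[OF id_iso])

lemma order_isomorphic_lex_product_self_iff:
  assumes "s \<cong>\<^sub>o t"
  shows "r \<otimes>\<^sub>l s \<cong>\<^sub>o s \<longleftrightarrow> r \<otimes>\<^sub>l t \<cong>\<^sub>o t"
  using assms order_isomorphic_lex_product_right order_isomorphic_sym order_isomorphic_trans
  by metis

lemma order_isomorphic_lex_product_assoc: "(r \<otimes>\<^sub>l s) \<otimes>\<^sub>l t \<cong>\<^sub>o r \<otimes>\<^sub>l (s \<otimes>\<^sub>l t)"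
  unfolding lex_product_eq_lex_sum by (rule order_isomorphic_lex_sum_assoc)

lemma interval_lex_sum_same_fibre:
  assumes "antisym r"
  shows "interval (lex_sum r I) (a, x) (a, y) \<subseteq> Pair a ` interval (I a) x y"
  using antisymD[OF assms] by (auto simp: interval_def lex_sum_iff)

section \<open>Isomorphisms of sums that map fibres to fibres\<close>

definition fibre_preserving :: "('a \<times> 'b) set \<Rightarrow> ('a \<times> 'b \<Rightarrow> 'c \<times> 'd) \<Rightarrow> bool" where
  "fibre_preserving S f \<longleftrightarrow> (\<forall>p\<in>S. \<forall>p'\<in>S. fst p = fst p' \<longrightarrow> fst (f p) = fst (f p'))"

lemma fibre_preservingD:
  "fibre_preserving S f \<Longrightarrow> p \<in> S \<Longrightarrow> p' \<in> S \<Longrightarrow> fst p = fst p' \<Longrightarrow> fst (f p) = fst (f p')"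
  unfolding fibre_preserving_def by blast

definition base_map :: "('a \<Rightarrow> 'b rel) \<Rightarrow> ('a \<times> 'b \<Rightarrow> 'c \<times> 'd) \<Rightarrow> 'a \<Rightarrow> 'c" where
  "base_map I f a = fst (f (a, SOME x. x \<in> Field (I a)))"

lemma fst_eq_base_map:
  assumes "fibre_preserving (Field (lex_sum r I)) f" "p \<in> Field (lex_sum r I)"
  shows "fst (f p) = base_map I f (fst p)"
proof -
  obtain a x where p: "p = (a, x)" "a \<in> Field r" "x \<in> Field (I a)"
    using assms(2) by (auto simp: Field_lex_sum)
  then have "(SOME x. x \<in> Field (I a)) \<in> Field (I a)"
    by (intro someI)
  then have "(a, SOME x. x \<in> Field (I a)) \<in> Field (lex_sum r I)"
    using p(2) by (simp add: Field_lex_sum)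
  with assms have "fst (f p) = fst (f (a, SOME x. x \<in> Field (I a)))"
    by (rule fibre_preservingD) (simp add: p(1))
  then show ?thesis
    by (simp add: base_map_def p(1))
qed

lemma fst_image_Field_lex_sum:
  assumes "\<And>a. a \<in> Field r \<Longrightarrow> Field (I a) \<noteq> {}"
  shows "fst ` Field (lex_sum r I) = Field r"
  using assms by (auto simp: Field_lex_sum fst_image_Sigma)

lemma image_base_map:
  assumes I: "\<And>a. a \<in> Field r \<Longrightarrow> Field (I a) \<noteq> {}"
    and J: "\<And>b. b \<in> Field q \<Longrightarrow> Field (J b) \<noteq> {}"
    and f: "iso (lex_sum r I) (lex_sum q J) f"
    and pres: "fibre_preserving (Field (lex_sum r I)) f"
  shows "base_map I f ` Field r = Field q"
proof -
  have "base_map I f ` Field r = (\<lambda>p. base_map I f (fst p)) ` Field (lex_sum r I)"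
    using I by (simp add: fst_image_Field_lex_sum flip: image_image)
  also have "\<dots> = (\<lambda>p. fst (f p)) ` Field (lex_sum r I)"
    by (rule image_cong) (simp_all add: fst_eq_base_map[OF pres])
  also have "\<dots> = fst ` Field (lex_sum q J)"
    by (simp add: iso_Field[OF f] flip: image_image)
  also have "\<dots> = Field q"
    using J by (rule fst_image_Field_lex_sum)
  finally show ?thesis .
qed

lemma fst_eq_if_fibre_preserving_inv_into:
  assumes "fibre_preserving (f ` S) (inv_into S f)" "inj_on f S"
    and "p \<in> S" "p' \<in> S" "fst (f p) = fst (f p')"
  shows "fst p = fst p'"
proof -
  have "fst (inv_into S f (f p)) = fst (inv_into S f (f p'))"
    using assms by (intro fibre_preservingD[OF assms(1)]) simp_all
  then show ?thesis
    using assms(2-4) by simp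
qed

lemma iso_base_map:
  assumes r: "Linear_order r" and q: "Linear_order q"
    and I: "\<And>a. a \<in> Field r \<Longrightarrow> Field (I a) \<noteq> {}"
    and J: "\<And>b. b \<in> Field q \<Longrightarrow> Field (J b) \<noteq> {}"
    and f: "iso (lex_sum r I) (lex_sum q J) f"
    and pres: "fibre_preserving (Field (lex_sum r I)) f"
    and pres_inv: "fibre_preserving (Field (lex_sum q J)) (inv_into (Field (lex_sum r I)) f)"
  shows "iso r q (base_map I f)"
  using r q
proof (rule iso_if_strict_mono_surj)
  show "base_map I f ` Field r = Field q"
    using I J f pres by (rule image_base_map)
  fix a b assume ab: "(a, b) \<in> r" "a \<noteq> b"
  then have "a \<in> Field r" "b \<in> Field r"
    by (auto intro: FieldI1 FieldI2)
  moreover from this obtain x y where "x \<in> Field (I a)" "y \<in> Field (I b)"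
    using I by blast
  ultimately have fields: "(a, x) \<in> Field (lex_sum r I)" "(b, y) \<in> Field (lex_sum r I)"
    and less: "((a, x), (b, y)) \<in> lex_sum r I"
    using ab by (auto simp: Field_lex_sum lex_sum_iff)
  have ne: "fst (f (a, x)) \<noteq> fst (f (b, y))"
    using fst_eq_if_fibre_preserving_inv_into[OF _ iso_imp_inj_on[OF f] fields] pres_inv ab(2)
    by (auto simp: iso_Field[OF f])
  have "(f (a, x), f (b, y)) \<in> lex_sum q J"
    using less f by (rule iso_forward)
  with ne have "(fst (f (a, x)), fst (f (b, y))) \<in> q"
    by (cases "f (a, x)"; cases "f (b, y)") (simp add: lex_sum_iff)
  with ne show "(base_map I f a, base_map I f b) \<in> q \<and> base_map I f a \<noteq> base_map I f b"
    using fields[THEN fst_eq_base_map[OF pres]] by simp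
qed

lemma
  assumes f: "iso (lex_sum r I) (lex_sum q J) f"
    and pres: "fibre_preserving (Field (lex_sum r I)) f"
    and a: "a \<in> Field r" and x: "x \<in> Field (I a)"
  shows base_map_in_Field: "base_map I f a \<in> Field q"
    and image_in_fibre: "f (a, x) \<in> Pair (base_map I f a) ` Field (J (base_map I f a))"
proof -
  have ax: "(a, x) \<in> Field (lex_sum r I)"
    using a x by (simp add: Field_lex_sum)
  then have "f (a, x) \<in> Field (lex_sum q J)"
    unfolding iso_Field[OF f, symmetric] by (rule imageI)
  moreover have "fst (f (a, x)) = base_map I f a"
    using fst_eq_base_map[OF pres ax] by simp
  ultimately show "base_map I f a \<in> Field q"
    and "f (a, x) \<in> Pair (base_map I f a) ` Field (J (base_map I f a))"
    by (auto simp: Field_lex_sum)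
qed

lemma image_fibre_eq_fibre:
  assumes f: "iso (lex_sum r I) (lex_sum q J) f"
    and pres: "fibre_preserving (Field (lex_sum r I)) f"
    and inj: "inj_on (base_map I f) (Field r)"
    and a: "a \<in> Field r" "Field (I a) \<noteq> {}"
  shows "f ` Pair a ` Field (I a) = Pair (base_map I f a) ` Field (J (base_map I f a))"
proof
  show "f ` Pair a ` Field (I a) \<subseteq> Pair (base_map I f a) ` Field (J (base_map I f a))"
    using image_in_fibre[OF f pres a(1)] by blast
  show "Pair (base_map I f a) ` Field (J (base_map I f a)) \<subseteq> f ` Pair a ` Field (I a)"
  proof clarify
    fix y assume "y \<in> Field (J (base_map I f a))"
    then have "(base_map I f a, y) \<in> f ` Field (lex_sum r I)"
      unfolding iso_Field[OF f] using a base_map_in_Field[OF f pres a(1)]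
      by (auto simp: Field_lex_sum)
    then obtain p where p: "p \<in> Field (lex_sum r I)" "f p = (base_map I f a, y)"
      by (metis imageE)
    then have "fst p = a"
      using fst_eq_base_map[OF pres p(1)] inj a(1) by (auto simp: Field_lex_sum dest: inj_onD)
    then show "(base_map I f a, y) \<in> f ` Pair a ` Field (I a)"
      using p by (force simp: Field_lex_sum)
  qed
qed

lemma iso_fibre:
  assumes f: "iso (lex_sum r I) (lex_sum q J) f"
    and pres: "fibre_preserving (Field (lex_sum r I)) f"
    and inj: "inj_on (base_map I f) (Field r)"
    and a: "a \<in> Field r" "Field (I a) \<noteq> {}"
  shows "iso (I a) (J (base_map I f a)) (\<lambda>x. snd (f (a, x)))"
proof -
  define b where "b = base_map I f a"
  define k where "k x = snd (f (a, x))" for x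
  have image_fibre: "f ` Pair a ` Field (I a) = Pair b ` Field (J b)"
    unfolding b_def using assms by (rule image_fibre_eq_fibre)
  have f_eq: "f (a, x) = (b, k x)" if "x \<in> Field (I a)" for x
    using image_in_fibre[OF f pres a(1) that] by (auto simp: b_def k_def)
  have "k ` Field (I a) = snd ` f ` Pair a ` Field (I a)"
    by (simp add: k_def image_image)
  also have "\<dots> = Field (J b)"
    unfolding image_fibre by (simp add: image_image)
  finally have image_k: "k ` Field (I a) = Field (J b)" .
  moreover have "inj_on k (Field (I a))"
    using iso_imp_inj_on[OF f] a f_eq by (fastforce simp: inj_on_def Field_lex_sum)
  moreover have "(x, y) \<in> I a \<longleftrightarrow> (k x, k y) \<in> J b"
    if xy: "x \<in> Field (I a)" "y \<in> Field (I a)" for x y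
  proof -
    have "(a, x) \<in> Field (lex_sum r I)" "(a, y) \<in> Field (lex_sum r I)"
      using a xy by (simp_all add: Field_lex_sum)
    then have "((a, x), (a, y)) \<in> lex_sum r I \<longleftrightarrow> ((b, k x), (b, k y)) \<in> lex_sum q J"
      using f xy unfolding iso_iff2 by (metis f_eq)
    moreover have "b \<in> Field q" "k x \<in> Field (J b)" "k y \<in> Field (J b)"
      using base_map_in_Field[OF f pres a(1) xy(1)] xy image_k by (auto simp: b_def)
    ultimately show ?thesis
      using a xy by (simp add: lex_sum_iff)
  qed
  ultimately show ?thesis
    unfolding b_def k_def by (simp add: iso_iff2 bij_betw_def)
qed

section \<open>Orders without least element whose final segments are well-ordered\<close>

definition has_least :: "'a rel \<Rightarrow> 'a set \<Rightarrow> bool" where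
  "has_least r S \<longleftrightarrow> (\<exists>m\<in>S. \<forall>x\<in>S. (m, x) \<in> r)"

definition bottomless_well_order :: "'a rel \<Rightarrow> bool" where
  "bottomless_well_order r \<longleftrightarrow>
     Linear_order r \<and> Field r \<noteq> {} \<and> \<not> has_least r (Field r) \<and>
     (\<forall>S b. S \<noteq> {} \<longrightarrow> (\<forall>x\<in>S. (b, x) \<in> r) \<longrightarrow> has_least r S)"

lemma has_least_if_bounded_below:
  "bottomless_well_order r \<Longrightarrow> S \<noteq> {} \<Longrightarrow> (\<And>x. x \<in> S \<Longrightarrow> (b, x) \<in> r) \<Longrightarrow> has_least r S"
  by (auto simp: bottomless_well_order_def)

lemma bottomless_well_order_ex_less:
  assumes "bottomless_well_order r" "x \<in> Field r"
  obtains y where "(y, x) \<in> r" "y \<noteq> x"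
proof -
  have r: "Linear_order r" and "\<not> has_least r (Field r)"
    using assms(1) by (simp_all add: bottomless_well_order_def)
  then obtain y where "y \<in> Field r" "(x, y) \<notin> r"
    using assms(2) by (auto simp: has_least_def)
  then have "(y, x) \<in> r" "y \<noteq> x"
    using assms(2) Linear_order_linear[OF r] by metis+
  then show thesis
    by (rule that)
qed

text \<open>
  The part of \<open>I a\<close> above \<open>x\<close> that is sent beyond the fibre of the image of \<open>x\<close> would have a least
  element, which would be sent to the least element of a fibre.
\<close>

lemma bottomless_well_order_same_fibre:
  assumes r: "antisym r" and I: "bottomless_well_order (I a)"
    and J: "\<And>b. b \<in> Field q \<Longrightarrow> bottomless_well_order (J b)"
    and f: "iso (lex_sum r I) (lex_sum q J) f"
    and a: "a \<in> Field r" and xy: "(x, y) \<in> I a"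
  shows "fst (f (a, y)) = fst (f (a, x))"
proof (rule ccontr)
  assume y: "fst (f (a, y)) \<noteq> fst (f (a, x))"
  define S where "S = {z. (x, z) \<in> I a \<and> fst (f (a, z)) \<noteq> fst (f (a, x))}"
  have "has_least (I a) S"
    by (rule has_least_if_bounded_below[OF I, of S x]) (use xy y in \<open>auto simp: S_def\<close>)
  then obtain m where m: "m \<in> S" and least: "\<And>z. z \<in> S \<Longrightarrow> (m, z) \<in> I a"
    by (auto simp: has_least_def)
  have fields: "(a, x) \<in> Field (lex_sum r I)" "(a, m) \<in> Field (lex_sum r I)"
    using a m by (auto simp: S_def Field_lex_sum intro: FieldI1 FieldI2)
  obtain w k where f_m: "f (a, m) = (w, k)"
    by fastforce
  have w_k: "w \<in> Field q" "k \<in> Field (J w)"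
    using fields(2) iso_Field[OF f] unfolding Field_lex_sum by (metis f_m imageI mem_Sigma_iff)+
  obtain l where l: "(l, k) \<in> J w" "l \<noteq> k"
    using bottomless_well_order_ex_less[OF J[OF w_k(1)] w_k(2)] .
  have "((a, x), (a, m)) \<in> lex_sum r I"
    using fields m by (auto simp: S_def lex_sum_iff Field_lex_sum)
  then have "(f (a, x), (w, k)) \<in> lex_sum q J"
    using iso_forward[OF _ f] f_m by metis
  then have "(w, l) \<in> interval (lex_sum q J) (f (a, x)) (f (a, m))"
    using w_k l m by (cases "f (a, x)") (auto simp: interval_def f_m S_def lex_sum_iff intro: FieldI1)
  then obtain p where p: "p \<in> interval (lex_sum r I) (a, x) (a, m)" "f p = (w, l)"
    using iso_image_interval[OF f fields] by (metis imageE)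
  then obtain z where z: "z \<in> interval (I a) x m" "f (a, z) = (w, l)"
    using subsetD[OF interval_lex_sum_same_fibre[OF r] p(1)] p(2) by auto
  then have "z \<in> S"
    using m f_m by (simp add: S_def interval_def)
  then have "m = z"
    using least[of z] z(1) I antisymD[OF Linear_order_antisym, of "I a" m z]
    by (simp add: interval_def bottomless_well_order_def)
  then show False
    using z(2) f_m l(2) by simp
qed

lemma bottomless_well_order_fibre_preserving:
  assumes r: "antisym r"
    and I: "\<And>a. a \<in> Field r \<Longrightarrow> bottomless_well_order (I a)"
    and J: "\<And>b. b \<in> Field q \<Longrightarrow> bottomless_well_order (J b)"
    and f: "iso (lex_sum r I) (lex_sum q J) f"
  shows "fibre_preserving (Field (lex_sum r I)) f"
  unfolding fibre_preserving_def Field_lex_sum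
proof clarsimp
  fix a x y assume a: "a \<in> Field r" and "x \<in> Field (I a)" "y \<in> Field (I a)"
  then have "(x, y) \<in> I a \<or> (y, x) \<in> I a"
    using I by (simp add: bottomless_well_order_def Linear_order_linear)
  then show "fst (f (a, x)) = fst (f (a, y))"
    using bottomless_well_order_same_fibre[OF r I[OF a] J f a] by metis
qed

proposition lex_sum_bottomless_well_orders_isoD:
  assumes r: "Linear_order r" and q: "Linear_order q"
    and I: "\<And>a. a \<in> Field r \<Longrightarrow> bottomless_well_order (I a)"
    and J: "\<And>b. b \<in> Field q \<Longrightarrow> bottomless_well_order (J b)"
    and "lex_sum r I \<cong>\<^sub>o lex_sum q J"
  obtains g where "iso r q g" "\<And>a. a \<in> Field r \<Longrightarrow> I a \<cong>\<^sub>o J (g a)"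
proof -
  obtain f where f: "iso (lex_sum r I) (lex_sum q J) f"
    using assms(5) by (auto simp: order_isomorphic_def)
  have pres: "fibre_preserving (Field (lex_sum r I)) f"
    using Linear_order_antisym[OF r] I J f by (rule bottomless_well_order_fibre_preserving)
  have "fibre_preserving (Field (lex_sum q J)) (inv_into (Field (lex_sum r I)) f)"
    using Linear_order_antisym[OF q] J I iso_inv_into[OF f]
    by (rule bottomless_well_order_fibre_preserving)
  then have g: "iso r q (base_map I f)"
    using r q I J f pres by (intro iso_base_map) (auto simp: bottomless_well_order_def)
  then have "I a \<cong>\<^sub>o J (base_map I f a)" if "a \<in> Field r" for a
    using iso_fibre[OF f pres iso_imp_inj_on that] I[OF that]
    by (auto simp: order_isomorphic_def bottomless_well_order_def)
  with g show thesis
    by (rule that)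
qed

section \<open>Pairwise non-isomorphic orders \<open>\<int> + \<alpha>\<close>\<close>

definition int_plus :: "'a rel \<Rightarrow> (int + 'a) rel" where
  "int_plus r = {(Inl m, Inl n) |m n. m \<le> n} \<union> {(Inl m, Inr x) |m x. x \<in> Field r}
     \<union> {(Inr x, Inr y) |x y. (x, y) \<in> r}"

lemma int_plus_simps [simp]:
  "(Inl m, Inl n) \<in> int_plus r \<longleftrightarrow> m \<le> n"
  "(Inl m, Inr y) \<in> int_plus r \<longleftrightarrow> y \<in> Field r"
  "(Inr x, Inl n) \<notin> int_plus r"
  "(Inr x, Inr y) \<in> int_plus r \<longleftrightarrow> (x, y) \<in> r"
  by (auto simp: int_plus_def)

lemma Field_int_plus: "Field (int_plus r) = UNIV <+> Field r"
proof
  show "Field (int_plus r) \<subseteq> UNIV <+> Field r"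
    by (auto simp: Field_def int_plus_def)
  show "UNIV <+> Field r \<subseteq> Field (int_plus r)"
  proof
    fix p :: "int + 'a" assume "p \<in> UNIV <+> Field r"
    then have "(Inl 0, p) \<in> int_plus r \<or> (p, Inl 0) \<in> int_plus r"
      by auto
    then show "p \<in> Field (int_plus r)"
      by (auto intro: FieldI1 FieldI2)
  qed
qed

lemma Inr_in_Field_int_plus [simp]: "Inr x \<in> Field (int_plus r) \<longleftrightarrow> x \<in> Field r"
  by (auto simp: Field_int_plus)

lemma Linear_order_int_plus:
  assumes "Linear_order r"
  shows "Linear_order (int_plus r)"
proof -
  have "Refl (int_plus r)"
    using Linear_order_refl[OF assms] by (auto simp: refl_on_def Field_int_plus)
  moreover have "int_plus r \<subseteq> Field (int_plus r) \<times> Field (int_plus r)"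
    by (auto intro: FieldI1 FieldI2)
  moreover have "antisym (int_plus r)"
    using antisymD[OF Linear_order_antisym[OF assms]]
    by (auto simp: antisym_def int_plus_def)
  moreover have "trans (int_plus r)"
    using Linear_order_trans[OF assms]
    by (auto simp: trans_def int_plus_def intro: FieldI1 FieldI2)
  moreover have "Total (int_plus r)"
    using Linear_order_linear[OF assms] by (fastforce simp: total_on_def Field_int_plus)
  ultimately show ?thesis
    by (simp add: order_on_defs)
qed

lemma ex_least_int_bounded_below:
  fixes N :: "int set"
  assumes "N \<noteq> {}" "\<And>n. n \<in> N \<Longrightarrow> l \<le> n"
  shows "\<exists>m\<in>N. \<forall>n\<in>N. m \<le> n"
proof -
  obtain n\<^sub>0 where "n\<^sub>0 \<in> N"
    using assms(1) by blast
  with wf_int_ge_less_than[of l] obtain m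
    where m: "m \<in> N" "\<And>n. (n, m) \<in> int_ge_less_than l \<Longrightarrow> n \<notin> N"
    by (rule wfE_min) blast
  have "m \<le> n" if "n \<in> N" for n
    using m(2)[of n] assms(2)[OF that] that by (intro leI) (auto simp: int_ge_less_than_def)
  then show ?thesis
    using m(1) by blast
qed

lemma has_least_int_plus:
  assumes r: "Well_order r" and S: "S \<noteq> {}" "\<And>p. p \<in> S \<Longrightarrow> (b, p) \<in> int_plus r"
  shows "has_least (int_plus r) S"
proof -
  have S_Field: "x \<in> Field r" if "Inr x \<in> S" for x
    using FieldI2[OF S(2)[OF that]] by simp
  show ?thesis
  proof (cases "Inl -` S = {}")
    case True
    then have S_Inr: "p \<in> range Inr" if "p \<in> S" for p
      using that by (cases p) auto
    then have "Inr -` S \<noteq> {}"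
      using S(1) by blast
    moreover have "Inr -` S \<subseteq> Field r"
      using S_Field by auto
    ultimately obtain x where x: "x \<in> Inr -` S" "\<forall>y\<in>Inr -` S. (x, y) \<in> r"
      using r Linear_order_Well_order_iff[of r] unfolding well_order_on_def by blast
    then have "(Inr x, p) \<in> int_plus r" if "p \<in> S" for p
      using S_Inr[OF that] that by auto
    then show ?thesis
      using x(1) by (auto simp: has_least_def)
  next
    case False
    then obtain l where "b = Inl l"
      using S(2) by (cases b) force+
    then have "l \<le> n" if "n \<in> Inl -` S" for n
      using S(2)[of "Inl n"] that by simp
    with False obtain m where m: "m \<in> Inl -` S" "\<And>n. n \<in> Inl -` S \<Longrightarrow> m \<le> n"
      using ex_least_int_bounded_below by metis
    then have "(Inl m, p) \<in> int_plus r" if "p \<in> S" for p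
      using that S_Field by (cases p) auto
    then show ?thesis
      using m(1) by (auto simp: has_least_def)
  qed
qed

lemma bottomless_well_order_int_plus:
  assumes "Well_order r"
  shows "bottomless_well_order (int_plus r)"
  unfolding bottomless_well_order_def
proof (intro conjI allI impI)
  show "Linear_order (int_plus r)"
    using assms by (simp add: Linear_order_int_plus well_order_on_def)
  show "Field (int_plus r) \<noteq> {}"
    by (auto simp: Field_int_plus)
  show "\<not> has_least (int_plus r) (Field (int_plus r))"
  proof
    assume "has_least (int_plus r) (Field (int_plus r))"
    then obtain p where "\<forall>n. (p, Inl n) \<in> int_plus r"
      by (auto simp: has_least_def Field_int_plus)
    then show False
      by (cases p) (auto dest: spec[of _ "_ - 1"])
  qed
  show "has_least (int_plus r) S" if "S \<noteq> {}" "\<forall>x\<in>S. (b, x) \<in> int_plus r" for S b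
    using assms that has_least_int_plus by blast
qed

lemma isl_iff_finite_intervals_int_plus:
  assumes "p \<in> Field (int_plus r)"
  shows "isl p \<longleftrightarrow> (\<forall>q\<in>Field (int_plus r). finite (interval (int_plus r) q p))"
proof (cases p)
  case (Inl n)
  have "finite (interval (int_plus r) q p)" for q
  proof (cases q)
    case q: (Inl m)
    have "interval (int_plus r) q p \<subseteq> Inl ` {m..n}"
      unfolding Inl q by (auto simp: interval_def int_plus_def)
    then show ?thesis
      by (rule finite_subset) simp
  next
    case (Inr x)
    then have "interval (int_plus r) q p = {}"
      unfolding Inl by (auto simp: interval_def int_plus_def)
    then show ?thesis
      by simp
  qed
  then show ?thesis
    using Inl by simp
next
  case (Inr x)
  then have "Inl ` {0..} \<subseteq> interval (int_plus r) (Inl 0) p"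
    using assms by (auto simp: interval_def Field_int_plus)
  moreover have "infinite (Inl ` {0::int..} :: (int + 'a) set)"
    by (simp add: finite_image_iff infinite_Ici)
  ultimately have "infinite (interval (int_plus r) (Inl 0) p)"
    using finite_subset by blast
  then show ?thesis
    using Inr by (auto simp: Field_int_plus)
qed

lemma isl_iso_int_plus:
  assumes f: "iso (int_plus r) (int_plus s) f" and p: "p \<in> Field (int_plus r)"
  shows "isl (f p) \<longleftrightarrow> isl p"
proof -
  have f_p: "f p \<in> Field (int_plus s)"
    using p iso_Field[OF f] by blast
  have finite_iff:
    "finite (interval (int_plus s) (f q) (f p)) \<longleftrightarrow> finite (interval (int_plus r) q p)"
    if "q \<in> Field (int_plus r)" for q
    using iso_image_interval[OF f that p] iso_imp_inj_on[OF f] interval_subset_Field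
    by (metis finite_image_iff inj_on_subset)
  have "isl (f p) \<longleftrightarrow>
      (\<forall>q\<in>f ` Field (int_plus r). finite (interval (int_plus s) q (f p)))"
    unfolding iso_Field[OF f] using f_p by (rule isl_iff_finite_intervals_int_plus)
  also have "\<dots> \<longleftrightarrow> (\<forall>q\<in>Field (int_plus r). finite (interval (int_plus r) q p))"
    using finite_iff by simp
  also have "\<dots> \<longleftrightarrow> isl p"
    using p by (rule isl_iff_finite_intervals_int_plus[symmetric])
  finally show ?thesis .
qed

lemma image_Inr_iso_int_plus:
  assumes f: "iso (int_plus r) (int_plus s) f"
  shows "f ` Inr ` Field r = Inr ` Field s"
proof -
  have Inr_Field: "Inr ` Field t = {p \<in> Field (int_plus t). \<not> isl p}" for t :: "'c rel"
    by (auto simp: Field_int_plus)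
  have "f ` {p \<in> Field (int_plus r). \<not> isl p} = {p \<in> f ` Field (int_plus r). \<not> isl p}"
    using isl_iso_int_plus[OF f] by auto
  then show ?thesis
    unfolding Inr_Field iso_Field[OF f] .
qed

text \<open>With \<open>\<omega>\<^sup>*\<close> in place of \<open>\<int>\<close> this would fail, as \<open>\<omega>\<^sup>* + 1 \<cong> \<omega>\<^sup>*\<close>.\<close>

lemma int_plus_cancel:
  assumes "int_plus r \<cong>\<^sub>o int_plus s"
  shows "r \<cong>\<^sub>o s"
proof -
  obtain f where f: "iso (int_plus r) (int_plus s) f"
    using assms by (auto simp: order_isomorphic_def)
  define g where "g x = projr (f (Inr x))" for x
  have f_Inr: "f (Inr x) = Inr (g x)" if "x \<in> Field r" for x
  proof -
    have "f (Inr x) \<in> Inr ` Field s"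
      unfolding image_Inr_iso_int_plus[OF f, symmetric] using that by blast
    then show ?thesis
      by (auto simp: g_def)
  qed
  have "g ` Field r = projr ` f ` Inr ` Field r"
    by (simp add: g_def image_image)
  also have "\<dots> = Field s"
    unfolding image_Inr_iso_int_plus[OF f] by (simp add: image_image)
  finally have "g ` Field r = Field s" .
  moreover have "inj_on g (Field r)"
  proof (rule inj_onI)
    fix x y assume "x \<in> Field r" "y \<in> Field r" "g x = g y"
    then show "x = y"
      using inj_onD[OF iso_imp_inj_on[OF f], of "Inr x" "Inr y"] f_Inr by simp
  qed
  moreover have "(x, y) \<in> r \<longleftrightarrow> (g x, g y) \<in> s" if "x \<in> Field r" "y \<in> Field r" for x y
  proof -
    have "Inr x \<in> Field (int_plus r)" "Inr y \<in> Field (int_plus r)"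
      using that by simp_all
    then have "(Inr x, Inr y) \<in> int_plus r \<longleftrightarrow> (f (Inr x), f (Inr y)) \<in> int_plus s"
      using f unfolding iso_iff2 by blast
    then show ?thesis
      using that by (simp add: f_Inr)
  qed
  ultimately have "iso r s g"
    by (simp add: iso_iff2 bij_betw_def)
  then show ?thesis
    by (auto simp: order_isomorphic_def)
qed

lemma Restr_underS_isomorphic_imp_eq:
  includes cardinal_syntax
  assumes W: "Well_order W" and cd: "c \<in> Field W" "d \<in> Field W"
    and iso: "Restr W (underS W c) \<cong>\<^sub>o Restr W (underS W d)"
  shows "c = d"
proof -
  have W_lin: "Linear_order W"
    using W by (simp add: well_order_on_def)
  have ofilter: "wo_rel.ofilter W (underS W c)" for c
    using W by (simp add: wo_rel.underS_ofilter wo_rel_def)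
  have "Restr W (underS W c) =o Restr W (underS W d)"
    using iso Well_order_Restr[OF W] by (auto simp: ordIso_def order_isomorphic_def)
  then have "\<not> underS W c \<subset> underS W d" "\<not> underS W d \<subset> underS W c"
    using ofilter_subset_ordLess[OF W ofilter ofilter] not_ordLess_ordIso ordIso_symmetric
    by blast+
  moreover have "underS W c \<subseteq> underS W d \<or> underS W d \<subseteq> underS W c"
    using Linear_order_linear[OF W_lin cd] underS_incl_iff[OF W_lin] cd by auto
  ultimately have "(c, d) \<in> W" "(d, c) \<in> W"
    using underS_incl_iff[OF W_lin] cd by blast+
  then show ?thesis
    using antisymD[OF Linear_order_antisym[OF W_lin]] by blast
qed

proposition ex_nonisomorphic_bottomless_well_orders:
  obtains I :: "'s \<Rightarrow> (int + 's) rel" where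
    "\<And>c. bottomless_well_order (I c)" "\<And>c d. I c \<cong>\<^sub>o I d \<Longrightarrow> c = d"
proof -
  obtain W :: "'s rel" where W: "Well_order W" "Field W = UNIV"
    using well_ordering[where 'a = 's] by blast
  show thesis
  proof (rule that)
    show "bottomless_well_order (int_plus (Restr W (underS W c)))" for c
      using W(1) by (intro bottomless_well_order_int_plus Well_order_Restr)
    show "c = d" if "int_plus (Restr W (underS W c)) \<cong>\<^sub>o int_plus (Restr W (underS W d))" for c d
      using Restr_underS_isomorphic_imp_eq[OF W(1) _ _ int_plus_cancel[OF that]] W(2) by simp
  qed
qed

lemma ex_inj_int_sum:
  includes cardinal_syntax
  assumes "infinite (UNIV :: 's set)"
  shows "\<exists>e :: int + 's \<Rightarrow> 's. inj e"
proof -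
  have "|UNIV :: int set| \<le>o |UNIV :: nat set|"
    by (rule card_of_ordLeqI[of int_encode]) (auto intro: inj_int_encode)
  also have "|UNIV :: nat set| \<le>o |UNIV :: 's set|"
    using assms infinite_iff_card_of_nat by blast
  finally have "|(UNIV :: int set) <+> (UNIV :: 's set)| \<le>o |UNIV :: 's set|"
    using assms card_of_Plus_infinite2 ordIso_imp_ordLeq by blast
  then show ?thesis
    using card_of_ordLeq[of "(UNIV :: int set) <+> (UNIV :: 's set)" "UNIV :: 's set"] by auto
qed

section \<open>Sequences\<close>

lemma sim2_iff_sdrop:
  "sim2 S u v \<longleftrightarrow> u \<in> streams S \<and> v \<in> streams S \<and>
     (\<exists>m n. m mod 2 = n mod 2 \<and> sdrop m u = sdrop n v)"
proof
  assume "sim2 S u v"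
  then obtain p q w where "p \<in> lists S" "q \<in> lists S" "w \<in> streams S"
    "length p mod 2 = length q mod 2" "u = p @- w" "v = q @- w"
    by (auto simp: sim2_def)
  moreover from this have "sdrop (length p) u = sdrop (length q) v"
    by (simp add: sdrop_shift)
  ultimately show "u \<in> streams S \<and> v \<in> streams S \<and>
      (\<exists>m n. m mod 2 = n mod 2 \<and> sdrop m u = sdrop n v)"
    by (auto intro: shift_streams)
next
  assume "u \<in> streams S \<and> v \<in> streams S \<and> (\<exists>m n. m mod 2 = n mod 2 \<and> sdrop m u = sdrop n v)"
  then obtain m n where uv: "u \<in> streams S" "v \<in> streams S"
    and mn: "m mod 2 = n mod 2" "sdrop m u = sdrop n v"
    by auto
  have "stake m u \<in> lists S" "stake n v \<in> lists S" "sdrop n v \<in> streams S"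
    using uv by (auto simp: streams_iff_snth sdrop_snth in_set_conv_nth)
  then show "sim2 S u v"
    unfolding sim2_def using mn stake_sdrop[of m u] stake_sdrop[of n v]
    by (intro bexI[of _ "stake m u"] bexI[of _ "stake n v"] bexI[of _ "sdrop n v"]) auto
qed

lemma sim2_refl: "u \<in> streams S \<Longrightarrow> sim2 S u u"
  unfolding sim2_iff_sdrop by blast

lemma sim2_sym: "sim2 S u v \<Longrightarrow> sim2 S v u"
  unfolding sim2_iff_sdrop by metis

lemma sim2_trans:
  assumes "sim2 S u v" "sim2 S v w"
  shows "sim2 S u w"
proof -
  obtain k l m n where uv: "k mod 2 = l mod 2" "sdrop k u = sdrop l v"
    and vw: "m mod 2 = n mod 2" "sdrop m v = sdrop n w"
    using assms by (auto simp: sim2_iff_sdrop)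
  have "sdrop (k + m) u = sdrop (l + m) v"
    using uv(2) by (metis sdrop_add)
  also have "\<dots> = sdrop (n + l) w"
    using vw(2) by (metis sdrop_add add.commute)
  finally have "sdrop (k + m) u = sdrop (n + l) w" .
  moreover have "(k + m) mod 2 = (n + l) mod 2"
    using mod_add_cong[OF uv(1) vw(1)] by (simp add: add.commute)
  ultimately show ?thesis
    using assms unfolding sim2_iff_sdrop by metis
qed

lemma sim2_stl_stl:
  assumes "u \<in> streams S"
  shows "sim2 S u (stl (stl u))"
proof -
  have "sdrop 2 u = sdrop 0 (stl (stl u))"
    by (simp add: numeral_2_eq_2)
  then show ?thesis
    using assms unfolding sim2_iff_sdrop by (metis mod_self mod_0 streams_stl)
qed

lemma sim2_class_eq_iff:
  assumes "v \<in> streams S"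
  shows "{w. sim2 S u w} = {w. sim2 S v w} \<longleftrightarrow> sim2 S u v"
proof
  assume "{w. sim2 S u w} = {w. sim2 S v w}"
  then show "sim2 S u v"
    using sim2_refl[OF assms] by auto
next
  assume "sim2 S u v"
  then show "{w. sim2 S u w} = {w. sim2 S v w}"
    by (auto intro: sim2_trans sim2_sym)
qed

lemma parity_reversing_automorphism_if_sim2_stl:
  assumes "iso (omega_power A) (omega_power A) f"
    and "\<And>u. u \<in> streams (Field A) \<Longrightarrow> sim2 (Field A) (stl u) (f u)"
  shows "parity_reversing_automorphism A f"
  unfolding parity_reversing_automorphism_def
proof (intro conjI ballI)
  fix u a assume u: "u \<in> streams (Field A)" and a: "a \<in> Field A"
  have "sim2 (Field A) (f u) (stl u)"
    using assms(2)[OF u] by (rule sim2_sym)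
  moreover have "sim2 (Field A) (stl u) (a ## u)"
    using sim2_stl_stl[of "a ## u" "Field A"] u a by (auto simp: streams_Stream intro: sim2_sym)
  ultimately show "sim2 (Field A) (f u) (a ## u)"
    by (rule sim2_trans)
qed (rule assms(1))

lemma infinite_streams:
  assumes "a \<in> S" "b \<in> S" "a \<noteq> b"
  shows "infinite (streams S)"
proof
  assume finite: "finite (streams S)"
  have "inj_on (\<lambda>(c, u). c ## u) ({a, b} \<times> streams S)"
    by (auto simp: inj_on_def)
  moreover have "(\<lambda>(c, u). c ## u) ` ({a, b} \<times> streams S) \<subseteq> streams S"
    using assms by (auto intro: streams_Stream)
  ultimately have "card ({a, b} \<times> streams S) \<le> card (streams S)"
    using finite by (intro card_inj_on_le)
  then have "streams S = {}"
    using finite assms(3) by (simp add: card_cartesian_product)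
  then show False
    using sconst_streams[OF assms(1)] by simp
qed

lemma parity_reversing_automorphism_id:
  assumes "\<And>a b. a \<in> Field A \<Longrightarrow> b \<in> Field A \<Longrightarrow> a = b"
  shows "parity_reversing_automorphism A id"
proof (rule parity_reversing_automorphism_if_sim2_stl[OF id_iso])
  fix u assume u: "u \<in> streams (Field A)"
  then have "sset u \<subseteq> Field A"
    by (simp add: streams_iff_sset)
  then have "sset u = {shd u}"
    using assms shd_sset[of u] by blast
  then have "u = sconst (shd u)"
    by (simp only: sconst_alt)
  then have "stl u = u"
    by (metis id_apply siterate.simps(2))
  with u show "sim2 (Field A) (stl u) (id u)"
    by (simp add: sim2_refl)
qed

lemma omega_power_iff_shd_stl:
  "(u, v) \<in> omega_power A \<longleftrightarrow>
     u \<in> streams (Field A) \<and> v \<in> streams (Field A) \<and>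
     ((shd u, shd v) \<in> A \<and> shd u \<noteq> shd v \<or> shd u = shd v \<and> (stl u, stl v) \<in> omega_power A)"
proof -
  define less_at where "less_at u v n \<longleftrightarrow>
      (\<forall>m<n. u !! m = v !! m) \<and> u !! n \<noteq> v !! n \<and> (u !! n, v !! n) \<in> A" for u v n
  have omega_power_iff: "(u, v) \<in> omega_power A \<longleftrightarrow>
      u \<in> streams (Field A) \<and> v \<in> streams (Field A) \<and> (u = v \<or> (\<exists>n. less_at u v n))" for u v
    by (simp add: omega_power_def less_at_def)
  have "less_at u v 0 \<longleftrightarrow> (shd u, shd v) \<in> A \<and> shd u \<noteq> shd v"
    by (auto simp: less_at_def)
  moreover have "less_at u v (Suc n) \<longleftrightarrow> shd u = shd v \<and> less_at (stl u) (stl v) n" for n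
    by (auto simp: less_at_def All_less_Suc2)
  moreover have "(\<exists>n. less_at u v n) \<longleftrightarrow> less_at u v 0 \<or> (\<exists>n. less_at u v (Suc n))"
    by (metis nat.exhaust)
  moreover have "u = v \<longleftrightarrow> shd u = shd v \<and> stl u = stl v"
    by (auto intro: stream.expand)
  ultimately show ?thesis
    unfolding omega_power_iff by (auto intro: streams_stl)
qed

lemma iso_omega_power_lex_product:
  "iso (omega_power A) (A \<otimes>\<^sub>l omega_power A) (\<lambda>u. (shd u, stl u))"
  unfolding iso_iff2
proof (intro conjI ballI)
  show "bij_betw (\<lambda>u. (shd u, stl u)) (Field (omega_power A)) (Field (A \<otimes>\<^sub>l omega_power A))"
    unfolding lex_product_eq_lex_sum Field_lex_sum Field_omega_power
    by (rule bij_betwI[where g = "\<lambda>(a, u). a ## u"])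
      (auto intro: streams_shd streams_stl streams_Stream)
  show "(u, v) \<in> omega_power A \<longleftrightarrow> ((shd u, stl u), (shd v, stl v)) \<in> A \<otimes>\<^sub>l omega_power A"
    if "u \<in> Field (omega_power A)" "v \<in> Field (omega_power A)" for u v
    using that
    by (simp add: lex_product_def Field_omega_power streams_shd streams_stl
        omega_power_iff_shd_stl[of u v])
qed

lemma lex_product_lex_sum_omega_power:
  "A \<otimes>\<^sub>l lex_sum (omega_power A) J \<cong>\<^sub>o lex_sum (omega_power A) (\<lambda>u. J (stl u))"
proof -
  have "lex_sum (omega_power A) (\<lambda>u. J (stl u)) \<cong>\<^sub>o lex_sum (A \<otimes>\<^sub>l omega_power A) (\<lambda>p. J (snd p))"
    by (rule order_isomorphic_lex_sum_cong[OF iso_omega_power_lex_product])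
      (simp add: order_isomorphic_refl)
  also have "\<dots> \<cong>\<^sub>o A \<otimes>\<^sub>l lex_sum (omega_power A) J"
    unfolding lex_product_eq_lex_sum
    using order_isomorphic_lex_sum_assoc[of A "\<lambda>_. omega_power A" "\<lambda>p. J (snd p)"] by simp
  finally show ?thesis
    by (rule order_isomorphic_sym)
qed

proposition square_lex_product_lex_sum_omega_power:
  assumes "\<And>u. u \<in> streams (Field A) \<Longrightarrow> J (stl (stl u)) \<cong>\<^sub>o J u"
  shows "(A \<otimes>\<^sub>l A) \<otimes>\<^sub>l lex_sum (omega_power A) J \<cong>\<^sub>o lex_sum (omega_power A) J"
proof -
  have "(A \<otimes>\<^sub>l A) \<otimes>\<^sub>l lex_sum (omega_power A) J \<cong>\<^sub>o A \<otimes>\<^sub>l (A \<otimes>\<^sub>l lex_sum (omega_power A) J)"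
    by (rule order_isomorphic_lex_product_assoc)
  also have "\<dots> \<cong>\<^sub>o A \<otimes>\<^sub>l lex_sum (omega_power A) (\<lambda>u. J (stl u))"
    by (intro order_isomorphic_lex_product_right lex_product_lex_sum_omega_power)
  also have "\<dots> \<cong>\<^sub>o lex_sum (omega_power A) (\<lambda>u. J (stl (stl u)))"
    by (rule lex_product_lex_sum_omega_power)
  also have "\<dots> \<cong>\<^sub>o lex_sum (omega_power A) J"
    by (rule order_isomorphic_lex_sum_cong[OF id_iso]) (simp add: assms Field_omega_power)
  finally show ?thesis .
qed

proposition ex_parity_reversing_automorphism_if_isomorphic:
  assumes A: "Linear_order A" and J: "\<And>u. bottomless_well_order (J u)"
    and sim2: "\<And>u v. v \<in> streams (Field A) \<Longrightarrow> J u \<cong>\<^sub>o J v \<Longrightarrow> sim2 (Field A) u v"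
    and "A \<otimes>\<^sub>l lex_sum (omega_power A) J \<cong>\<^sub>o lex_sum (omega_power A) J"
  shows "\<exists>f. parity_reversing_automorphism A f"
proof -
  have P: "Linear_order (omega_power A)"
    using A by (rule Linear_order_omega_power)
  have "lex_sum (omega_power A) (\<lambda>u. J (stl u)) \<cong>\<^sub>o lex_sum (omega_power A) J"
    using lex_product_lex_sum_omega_power[THEN order_isomorphic_sym] assms(4)
    by (rule order_isomorphic_trans)
  with P P J J obtain f where f: "iso (omega_power A) (omega_power A) f"
    and J_f: "\<And>u. u \<in> Field (omega_power A) \<Longrightarrow> J (stl u) \<cong>\<^sub>o J (f u)"
    by (rule lex_sum_bottomless_well_orders_isoD) blast
  have "parity_reversing_automorphism A f"
    using f
  proof (rule parity_reversing_automorphism_if_sim2_stl)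
    fix u assume u: "u \<in> streams (Field A)"
    then have "f u \<in> streams (Field A)"
      using iso_Field[OF f] unfolding Field_omega_power by blast
    then show "sim2 (Field A) (stl u) (f u)"
      using J_f u by (intro sim2) (simp_all add: Field_omega_power)
  qed
  then show ?thesis
    by blast
qed

lemma infinite_stream_sets_if_no_parity_reversing_automorphism:
  fixes A :: "'a rel"
  assumes "\<not> (\<exists>f. parity_reversing_automorphism A f)"
  shows "infinite (UNIV :: 'a stream set set)"
proof -
  obtain a b where "a \<in> Field A" "b \<in> Field A" "a \<noteq> b"
    using assms parity_reversing_automorphism_id[of A] by metis
  then have "infinite (streams (Field A))"
    by (rule infinite_streams)
  then have "infinite (UNIV :: 'a stream set)"
    by (rule infinite_super[OF subset_UNIV])
  then show ?thesis
    by (simp add: Finite_Set.finite_set)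
qed

lemma ex_bottomless_well_orders_classifying_sim2:
  obtains J :: "'a stream \<Rightarrow> (int + 'a stream set) rel" where
    "\<And>u. bottomless_well_order (J u)"
    "\<And>u v. v \<in> streams S \<Longrightarrow> J u \<cong>\<^sub>o J v \<longleftrightarrow> sim2 S u v"
proof -
  obtain I :: "'a stream set \<Rightarrow> (int + 'a stream set) rel" where
    I: "\<And>C. bottomless_well_order (I C)" and I_inj: "\<And>C D. I C \<cong>\<^sub>o I D \<Longrightarrow> C = D"
    by (rule ex_nonisomorphic_bottomless_well_orders) blast
  show thesis
  proof (rule that)
    show "bottomless_well_order (I {w. sim2 S u w})" for u
      by (rule I)
    show "I {w. sim2 S u w} \<cong>\<^sub>o I {w. sim2 S v w} \<longleftrightarrow> sim2 S u v" if "v \<in> streams S" for u v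
      unfolding sim2_class_eq_iff[OF that, symmetric]
      using I_inj order_isomorphic_refl by metis
  qed
qed

theorem theorem6p2:
  fixes A :: "'a rel"
  assumes "Linear_order A"
    and "\<not> (\<exists>f. parity_reversing_automorphism A f)"
  shows "\<exists>X :: ('a stream \<times> 'a stream set) rel.
           Linear_order X \<and> (A \<otimes>\<^sub>l A) \<otimes>\<^sub>l X \<cong>\<^sub>o X \<and> \<not> (A \<otimes>\<^sub>l X \<cong>\<^sub>o X)"
proof -
  obtain J :: "'a stream \<Rightarrow> (int + 'a stream set) rel" where
    J: "\<And>u. bottomless_well_order (J u)"
    and J_iff: "\<And>u v. v \<in> streams (Field A) \<Longrightarrow> J u \<cong>\<^sub>o J v \<longleftrightarrow> sim2 (Field A) u v"
    by (rule ex_bottomless_well_orders_classifying_sim2[of "Field A"]) blast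
  define Y where "Y = lex_sum (omega_power A) J"
  have Y: "Linear_order Y"
    unfolding Y_def using Linear_order_omega_power[OF assms(1)] J
    by (intro Linear_order_lex_sum) (simp_all add: bottomless_well_order_def)
  have AAY: "(A \<otimes>\<^sub>l A) \<otimes>\<^sub>l Y \<cong>\<^sub>o Y"
    unfolding Y_def
    by (intro square_lex_product_lex_sum_omega_power) (simp add: J_iff sim2_stl_stl sim2_sym)
  have AY: "\<not> A \<otimes>\<^sub>l Y \<cong>\<^sub>o Y"
    using ex_parity_reversing_automorphism_if_isomorphic[of A J] assms J J_iff
    unfolding Y_def by auto
  obtain e :: "int + 'a stream set \<Rightarrow> 'a stream set" where "inj e"
    using ex_inj_int_sum infinite_stream_sets_if_no_parity_reversing_automorphism[OF assms(2)]
    by metis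
  then have e: "inj_on (map_prod id e) (Field Y)"
    by (auto simp: inj_on_def)
  then show ?thesis
    using Linear_order_dir_image[OF Y e] AAY AY
    unfolding order_isomorphic_lex_product_self_iff[OF order_isomorphic_dir_image[OF e]]
    by (intro exI[of _ "dir_image Y (map_prod id e)"] conjI)
qed

end
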